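(* Let $H$ be a finite simple graph with distinct vertices $u,v,w$ such that $uw$ is an edge of $H$ and $w$ is incident to no other edge. Let $G$ be obtained from $H-w$ by toggling the adjacency of $u$ and $v$ (so $uv\in E(G)$ iff $uv\notin E(H)$). Then for every real $x\ge 1$, $q(G;x)\le q(H;x)$.
   Context: The interlace polynomial $q$ is the unique map from finite simple graphs to $\mathbb{Z}[x]$ with $q(E_n)=x^n$ for the edgeless graph $E_n$ on $n$ vertices and $q(G)=q(G-a)+q(G^{ab}-b)$ for every edge $ab$ of $G$; here the pivot $G^{ab}$ is obtained by partitioning the vertices other than $a,b$ into (1) adjacent to $a$ only, (2) adjacent to $b$ only, (3) adjacent to both, (4) adjacent to neither, and toggling the adjacency of every pair $\{x,y\}$ with $x,y$ in two different classes among (1),(2),(3). *)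

theory Defs
  imports Complex_Main "HOL-Library.FuncSet" "HOL-Computational_Algebra.Polynomial"
begin

record 'a ugraph =
  verts :: "'a set"
  edges :: "'a set set"

definition finite_simple_graph :: "'a ugraph \<Rightarrow> bool" where
  "finite_simple_graph G \<longleftrightarrow>
     finite (verts G) \<and> (\<forall>e\<in>edges G. e \<subseteq> verts G \<and> card e = 2)"

definition del_vertex :: "'a ugraph \<Rightarrow> 'a \<Rightarrow> 'a ugraph" where
  "del_vertex G a = \<lparr>verts = verts G - {a}, edges = {e \<in> edges G. a \<notin> e}\<rparr>"

definition toggle_edges :: "'a ugraph \<Rightarrow> 'a set set \<Rightarrow> 'a ugraph" where
  "toggle_edges G F = \<lparr>verts = verts G, edges = sym_diff (edges G) F\<rparr>"

definition adj_only :: "'a ugraph \<Rightarrow> 'a \<Rightarrow> 'a \<Rightarrow> 'a set" where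
  "adj_only G a b = {x \<in> verts G - {a, b}. {a, x} \<in> edges G \<and> {b, x} \<notin> edges G}"

definition adj_both :: "'a ugraph \<Rightarrow> 'a \<Rightarrow> 'a \<Rightarrow> 'a set" where
  "adj_both G a b = {x \<in> verts G - {a, b}. {a, x} \<in> edges G \<and> {b, x} \<in> edges G}"

definition pivot :: "'a ugraph \<Rightarrow> 'a \<Rightarrow> 'a \<Rightarrow> 'a ugraph" where
  "pivot G a b = toggle_edges G
     {{x, y} | x y. (x, y) \<in> adj_only G a b \<times> adj_only G b a
                          \<union> adj_only G a b \<times> adj_both G a b
                          \<union> adj_only G b a \<times> adj_both G a b}"

text \<open>
  Extensionality fixes the values outside the finite simple graphs, so that a map on the
  finite simple graphs corresponds to exactly one HOL function. The recursion is required
  for both orderings of the end points of an edge.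
\<close>

definition is_interlace_map :: "('a ugraph \<Rightarrow> int poly) \<Rightarrow> bool" where
  "is_interlace_map q \<longleftrightarrow>
     q \<in> extensional {G. finite_simple_graph G} \<and>
     (\<forall>G. finite_simple_graph G \<and> edges G = {} \<longrightarrow> q G = monom 1 (card (verts G))) \<and>
     (\<forall>G a b. finite_simple_graph G \<and> {a, b} \<in> edges G \<longrightarrow>
        q G = q (del_vertex G a) + q (del_vertex (pivot G a b) b))"

definition interlace_poly :: "'a ugraph \<Rightarrow> int poly" where
  "interlace_poly = (THE q. is_interlace_map q)"

end

theory Submission
  imports Defs "HOL-Library.Z2"
begin

text \<open>
  With \<open>y = x - 1\<close>, the interlace polynomial is the sum of \<open>y ^ n(S)\<close> over all vertex sets
  \<open>S\<close>, where \<open>n(S)\<close> is the nullity over the two-element field of the adjacency matrix induced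
  on \<open>S\<close>: a pivot on \<open>ab\<close> is a change of basis matching the sets that contain \<open>a\<close> in \<open>G\<close> with
  the sets that avoid \<open>b\<close> in the pivoted graph.

  For the pendant vertex \<open>w\<close> the recursion gives \<open>q(H) = q(H - w) + x q(H - w - u)\<close>. In
  \<open>q(G) - q(H - w)\<close> only the sets \<open>T \<union> {u, v}\<close> survive. If toggling \<open>uv\<close> changes the
  nullity there, then \<open>v\<close> is orthogonal to the kernel on \<open>T\<close>, hence \<open>n(T \<union> {v}) = n(T) + 1\<close>;
  as adding a vertex moves the nullity by exactly one, the nullity on \<open>T \<union> {u, v}\<close> is
  \<open>n(T)\<close> or \<open>n(T \<union> {v}) + 1\<close>, and its power of \<open>y\<close> is dominated by the terms of
  \<open>x q(H - w - u)\<close> at \<open>T\<close> and \<open>T \<union> {v}\<close>.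
\<close>

section \<open>Alternating forms over the two-element field\<close>

text \<open>These two rules would rewrite field arithmetic on bits into propositional form.\<close>

declare add_bit_eq_xor [simp del] mult_bit_eq_and [simp del]

lemma bit_add_self [simp]: "(b::bit) + b = 0"
  by (cases b) simp_all

lemma bit_add_self_left [simp]: "(b::bit) + (b + c) = c"
  by (simp add: add.assoc[symmetric])

lemma bit_add_eq_0_iff: "(b::bit) + c = 0 \<longleftrightarrow> b = c"
  by (cases b; cases c) simp_all

text \<open>Vectors on \<open>S\<close> are extended by zero, so kernels for different
  \<open>S\<close> share one type and can be compared as sets.\<close>

definition kernel_on :: "('a \<Rightarrow> 'a \<Rightarrow> bit) \<Rightarrow> 'a set \<Rightarrow> ('a \<Rightarrow> bit) set" where
  "kernel_on B S = {f. (\<forall>t. t \<notin> S \<longrightarrow> f t = 0) \<and> (\<forall>s\<in>S. (\<Sum>t\<in>S. B s t * f t) = 0)}"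

text \<open>The dimension is read off from the number of kernel vectors, so kernels in bijection
  have equal nullity at once. For finite \<open>S\<close> and alternating \<open>B\<close> this
  number is a power of two by \<open>card_kernel_on\<close>.\<close>

definition nullity_on :: "('a \<Rightarrow> 'a \<Rightarrow> bit) \<Rightarrow> 'a set \<Rightarrow> nat" where
  "nullity_on B S = (THE n. card (kernel_on B S) = 2 ^ n)"

definition alternating_on :: "('a \<Rightarrow> 'a \<Rightarrow> bit) \<Rightarrow> 'a set \<Rightarrow> bool" where
  "alternating_on B S \<longleftrightarrow> (\<forall>s\<in>S. B s s = 0) \<and> (\<forall>s\<in>S. \<forall>t\<in>S. B s t = B t s)"

lemma alternating_on_subset: "alternating_on B S \<Longrightarrow> T \<subseteq> S \<Longrightarrow> alternating_on B T"
  by (auto simp: alternating_on_def)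

lemma kernel_on_cong:
  "(\<And>s t. s \<in> S \<Longrightarrow> t \<in> S \<Longrightarrow> B s t = C s t) \<Longrightarrow> kernel_on B S = kernel_on C S"
  by (simp add: kernel_on_def)

lemma nullity_on_cong:
  "(\<And>s t. s \<in> S \<Longrightarrow> t \<in> S \<Longrightarrow> B s t = C s t) \<Longrightarrow> nullity_on B S = nullity_on C S"
  using kernel_on_cong[of S B C] by (simp add: nullity_on_def)

lemma finite_kernel_on: "finite S \<Longrightarrow> finite (kernel_on B S)"
  by (rule finite_subset[OF _ finite_set_of_finite_funs[of S "{0, 1 :: bit}" 0]])
     (auto simp: kernel_on_def)

lemma add_in_kernel_on:
  "f \<in> kernel_on B S \<Longrightarrow> g \<in> kernel_on B S \<Longrightarrow> (\<lambda>t. f t + g t) \<in> kernel_on B S"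
  by (simp add: kernel_on_def algebra_simps sum.distrib)

section \<open>Kernel sizes of the zero form and of pivoted forms\<close>

lemma kernel_on_zero_form:
  assumes "finite S" "\<And>s t. s \<in> S \<Longrightarrow> t \<in> S \<Longrightarrow> B s t = 0"
  shows "card (kernel_on B S) = 2 ^ card S"
proof -
  have eq: "kernel_on B S = (\<lambda>X t. of_bool (t \<in> X)) ` Pow S" (is "_ = ?r ` _")
  proof (intro equalityI subsetI)
    fix f assume "f \<in> kernel_on B S"
    then have "f = ?r {t\<in>S. f t = 1}"
      by (intro ext) (auto simp: kernel_on_def)
    then show "f \<in> ?r ` Pow S" by blast
  qed (auto simp: kernel_on_def assms(2))
  have "inj_on ?r (Pow S)"
  proof (rule inj_onI)
    fix X Y assume "?r X = ?r Y"
    then have "t \<in> X \<longleftrightarrow> t \<in> Y" for t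
      by (auto dest!: fun_cong[of _ _ t] split: if_splits simp: of_bool_def)
    then show "X = Y" by blast
  qed
  then show ?thesis by (simp add: eq card_image card_Pow assms(1))
qed

text \<open>\<open>C\<close> is the Schur complement of the block on \<open>a\<close>,
  \<open>b\<close>: rows \<open>a\<close> and \<open>b\<close> determine \<open>f a\<close> and
  \<open>f b\<close> from \<open>f\<close> on \<open>T\<close>, and substituting these values in the
  other rows gives the equations of \<open>C\<close>.\<close>

lemma card_kernel_on_pivot:
  assumes "finite T" "a \<notin> T" "b \<notin> T" "a \<noteq> b"
    and alt: "alternating_on B (insert a (insert b T))" and ab: "B a b = 1"
    and C: "\<And>s t. s \<in> T \<Longrightarrow> t \<in> T \<Longrightarrow> C s t = B s t + B s b * B a t + B s a * B b t"
  shows "card (kernel_on C T) = card (kernel_on B (insert a (insert b T)))"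
proof -
  have sums: "(\<Sum>t\<in>insert a (insert b T). h t) = h a + h b + (\<Sum>t\<in>T. h t)" for h :: "'a \<Rightarrow> bit"
    using assms by (simp add: add.assoc)
  have B: "B a a = 0" "B b b = 0" "B b a = 1"
    using alt ab unfolding alternating_on_def by (blast, blast, metis insertI1 insertI2)
  have Csum: "(\<Sum>t\<in>T. C s t * f t)
      = B s a * (\<Sum>t\<in>T. B b t * f t) + B s b * (\<Sum>t\<in>T. B a t * f t) + (\<Sum>t\<in>T. B s t * f t)"
    if "s \<in> T" for s f
    using that by (simp add: C algebra_simps sum.distrib sum_distrib_left)
  \<comment> \<open>The values are crossed because row \<open>a\<close> contains \<open>f b\<close>
    but not \<open>f a\<close>, and row \<open>b\<close> conversely.\<close>
  let ?e = "\<lambda>f. f(a := \<Sum>t\<in>T. B b t * f t, b := \<Sum>t\<in>T. B a t * f t)"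
  let ?r = "\<lambda>f. f(a := 0, b := 0)"
  have upd: "(\<Sum>t\<in>T. D t * (f(a := p, b := q)) t) = (\<Sum>t\<in>T. D t * f t)" for D f p q
    using assms(2,3) by (intro sum.cong) auto
  have "bij_betw ?e (kernel_on C T) (kernel_on B (insert a (insert b T)))"
  proof (rule bij_betw_byWitness[where f' = ?r])
    show "\<forall>f\<in>kernel_on C T. ?r (?e f) = f"
      using assms by (auto simp: kernel_on_def)
    show "\<forall>f\<in>kernel_on B (insert a (insert b T)). ?e (?r f) = f"
    proof
      fix f assume f: "f \<in> kernel_on B (insert a (insert b T))"
      then have "f b = (\<Sum>t\<in>T. B a t * f t)" "f a = (\<Sum>t\<in>T. B b t * f t)"
        unfolding kernel_on_def sums by (auto simp: B ab bit_add_eq_0_iff)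
      then show "?e (?r f) = f" unfolding upd by auto
    qed
    show "?e ` kernel_on C T \<subseteq> kernel_on B (insert a (insert b T))"
      using \<open>a \<noteq> b\<close> unfolding kernel_on_def sums mem_Collect_eq image_subset_iff upd
      by (auto simp: Csum B ab)
    show "?r ` kernel_on B (insert a (insert b T)) \<subseteq> kernel_on C T"
    proof (rule image_subsetI)
      fix f assume f: "f \<in> kernel_on B (insert a (insert b T))"
      then have "f b = (\<Sum>t\<in>T. B a t * f t)" "f a = (\<Sum>t\<in>T. B b t * f t)"
        unfolding kernel_on_def sums by (auto simp: B ab bit_add_eq_0_iff)
      with f show "?r f \<in> kernel_on C T"
        unfolding kernel_on_def sums mem_Collect_eq upd by (auto simp: Csum)
    qed
  qed
  then show ?thesis by (rule bij_betw_same_card)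
qed

text \<open>\<open>C\<close> is congruent to \<open>B\<close> under the transvection that adds
  \<open>\<Sum>t\<in>T. c t * f t\<close> to coordinate \<open>a\<close>, an involution in
  characteristic two. No term \<open>c s * c t\<close> arises because
  \<open>B a a = 0\<close>.\<close>

lemma card_kernel_on_pivot_endpoint:
  assumes "finite T" "a \<notin> T" "B a a = 0"
    and C: "\<And>s t. s \<in> T \<Longrightarrow> t \<in> T \<Longrightarrow> C s t = B s t + c s * B a t + B s a * c t"
    and Ca: "\<And>t. t \<in> insert a T \<Longrightarrow> C a t = B a t \<and> C t a = B t a"
  shows "card (kernel_on C (insert a T)) = card (kernel_on B (insert a T))"
proof -
  have sums: "(\<Sum>t\<in>insert a T. h t) = h a + (\<Sum>t\<in>T. h t)" for h :: "'a \<Rightarrow> bit"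
    using assms by simp
  let ?e = "\<lambda>f. f(a := f a + (\<Sum>t\<in>T. c t * f t))"
  have upd: "(\<Sum>t\<in>T. D t * (f(a := p)) t) = (\<Sum>t\<in>T. D t * f t)" for D f p
    using assms(2) by (intro sum.cong) auto
  have Csum: "(\<Sum>t\<in>T. C s t * f t)
      = B s a * (\<Sum>t\<in>T. c t * f t) + c s * (\<Sum>t\<in>T. B a t * f t) + (\<Sum>t\<in>T. B s t * f t)"
    if "s \<in> T" for s f
    using that by (simp add: C algebra_simps sum.distrib sum_distrib_left)
  have CT: "(\<Sum>t\<in>T. C a t * f t) = (\<Sum>t\<in>T. B a t * f t)" for f
    using Ca by (intro sum.cong) auto
  have Ca': "C a a = 0" "s \<in> T \<Longrightarrow> C s a = B s a" for s
    using Ca \<open>B a a = 0\<close> by auto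
  \<comment> \<open>For \<open>s\<close> in \<open>T\<close> the two equations differ by
    \<open>c s\<close> times the equation of row \<open>a\<close>, which belongs to both
    systems.\<close>
  have iff: "?e f \<in> kernel_on B (insert a T) \<longleftrightarrow> f \<in> kernel_on C (insert a T)" for f
    unfolding kernel_on_def sums mem_Collect_eq upd
    by (auto simp: Csum CT Ca' \<open>B a a = 0\<close> distrib_left add.assoc)
  have inv: "?e (?e f) = f" for f
    unfolding upd by (auto simp: add.assoc)
  have "bij_betw ?e (kernel_on C (insert a T)) (kernel_on B (insert a T))"
  proof (rule bij_betw_byWitness[where f' = ?e])
    show "?e ` kernel_on C (insert a T) \<subseteq> kernel_on B (insert a T)"
      by (rule image_subsetI) (rule iff[THEN iffD2])
    show "?e ` kernel_on B (insert a T) \<subseteq> kernel_on C (insert a T)"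
      by (rule image_subsetI, rule iff[THEN iffD1], unfold inv)
  qed (use inv in blast)+
  then show ?thesis by (rule bij_betw_same_card)
qed

text \<open>Pivoting on a nonzero entry removes two rows and columns without changing the nullity,
  so the nullity has the parity of the size (the rank of an alternating form is even).\<close>

lemma card_kernel_on_power2:
  assumes "finite S" "alternating_on B S"
  shows "\<exists>n. card (kernel_on B S) = 2 ^ n \<and> even (n + card S)"
  using assms
proof (induction "card S" arbitrary: S B rule: less_induct)
  case less
  show ?case
  proof (cases "\<exists>a\<in>S. \<exists>b\<in>S. B a b = 1")
    case False
    then have "card (kernel_on B S) = 2 ^ card S"
      by (intro kernel_on_zero_form) (use less in \<open>auto\<close>)
    then show ?thesis by auto
  next
    case True
    then obtain a b where ab: "a \<in> S" "b \<in> S" "B a b = 1" by blast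
    define T where "T = S - {a, b}"
    have "a \<noteq> b" using ab less.prems by (auto simp: alternating_on_def)
    have S: "S = insert a (insert b T)" and T: "finite T" "a \<notin> T" "b \<notin> T"
      using ab less.prems by (auto simp: T_def)
    define C where "C s t = B s t + B s b * B a t + B s a * B b t" for s t
    have "alternating_on C T"
      unfolding alternating_on_def
    proof (intro conjI ballI)
      fix s t assume st: "s \<in> T" "t \<in> T"
      have sym: "B p q = B q p" if "p \<in> S" "q \<in> S" for p q
        using that less.prems by (auto simp: alternating_on_def)
      show "C s t = C t s"
        using sym[of s t] sym[of a s] sym[of a t] sym[of b s] sym[of b t] st
        by (simp add: C_def S add_ac mult_ac)
      have "B s s = 0"
        using st less.prems(2) unfolding alternating_on_def S by blast
      \<comment> \<open>The two cross terms coincide by symmetry and cancel in characteristic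
        two.\<close>
      then show "C s s = 0"
        using sym[of a s] sym[of b s] st by (simp add: C_def S mult_ac)
    qed
    moreover have cS: "card S = card T + 2"
      using S T \<open>a \<noteq> b\<close> by simp
    ultimately obtain n where "card (kernel_on C T) = 2 ^ n" "even (n + card T)"
      using less.hyps[of T C] T by auto
    moreover have "card (kernel_on C T) = card (kernel_on B S)"
      unfolding S using T \<open>a \<noteq> b\<close> ab(3) less.prems(2)
      by (intro card_kernel_on_pivot) (auto simp: S C_def)
    ultimately show ?thesis using cS by auto
  qed
qed

lemma
  assumes "finite S" "alternating_on B S"
  shows card_kernel_on: "card (kernel_on B S) = 2 ^ nullity_on B S"
    and even_nullity_on: "even (nullity_on B S + card S)"
proof -
  obtain n where n: "card (kernel_on B S) = 2 ^ n" "even (n + card S)"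
    using card_kernel_on_power2[OF assms] by blast
  moreover from n(1) have "nullity_on B S = n"
    unfolding nullity_on_def by (intro the_equality) auto
  ultimately show "card (kernel_on B S) = 2 ^ nullity_on B S" "even (nullity_on B S + card S)"
    by auto
qed

section \<open>Enlarging the index set by one element\<close>

lemma card_le_double_card_zeros:
  fixes \<phi> :: "('a \<Rightarrow> bit) \<Rightarrow> bit"
  assumes "finite K" "\<And>f g. f \<in> K \<Longrightarrow> g \<in> K \<Longrightarrow> (\<lambda>t. f t + g t) \<in> K"
    and \<phi>: "\<And>f g. f \<in> K \<Longrightarrow> g \<in> K \<Longrightarrow> \<phi> (\<lambda>t. f t + g t) = \<phi> f + \<phi> g"
  shows "card K \<le> 2 * card {f\<in>K. \<phi> f = 0}"
proof -
  have "card {f\<in>K. \<phi> f = 1} \<le> card {f\<in>K. \<phi> f = 0}"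
  proof (cases "\<exists>g\<in>K. \<phi> g = 1")
    case True
    then obtain g where g: "g \<in> K" "\<phi> g = 1" by blast
    \<comment> \<open>Translation by one \<open>g\<close> with value one moves all vectors of value
      one into the zero set, which is therefore at least half of \<open>K\<close>.\<close>
    have "inj_on (\<lambda>f t. f t + g t) {f\<in>K. \<phi> f = 1}"
      by (rule inj_onI) (metis (no_types, lifting) add_right_cancel ext)
    moreover have "(\<lambda>f t. f t + g t) ` {f\<in>K. \<phi> f = 1} \<subseteq> {f\<in>K. \<phi> f = 0}"
      using assms g by auto
    ultimately show ?thesis
      using \<open>finite K\<close> by (intro card_inj_on_le) auto
  next
    case False
    then have "{f\<in>K. \<phi> f = 1} = {}" by blast
    then show ?thesis by (metis card.empty le0)
  qed
  moreover have "K = {f\<in>K. \<phi> f = 0} \<union> {f\<in>K. \<phi> f = 1}" by auto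
  then have "card K \<le> card {f\<in>K. \<phi> f = 0} + card {f\<in>K. \<phi> f = 1}"
    by (metis (no_types, lifting) card_Un_le)
  ultimately show ?thesis by linarith
qed

text \<open>This subspace is common to the kernels on \<open>S\<close> and on
  \<open>insert v S\<close>. Each kernel is cut down by a single linear condition, so the index is
  at most two in either.\<close>

lemma kernel_on_insert_zeros:
  assumes "finite S" "v \<notin> S"
  shows "{f \<in> kernel_on B (insert v S). f v = 0}
       = {f \<in> kernel_on B S. (\<Sum>t\<in>S. B v t * f t) = 0}"
  using assms by (auto simp: kernel_on_def)

text \<open>The common subspace bounds the difference of the nullities by one, and the even rank of
  alternating forms excludes equality.\<close>

lemma nullity_on_insert:
  assumes "finite S" "v \<notin> S" "alternating_on B (insert v S)"
  shows "nullity_on B (insert v S) = nullity_on B S + 1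
       \<or> nullity_on B S = nullity_on B (insert v S) + 1"
proof -
  let ?m = "nullity_on B S" and ?n = "nullity_on B (insert v S)"
  let ?Z = "{f \<in> kernel_on B (insert v S). f v = 0}"
  have alt: "alternating_on B S"
    using alternating_on_subset[OF assms(3)] by blast
  have m: "card (kernel_on B S) = 2 ^ ?m" and n: "card (kernel_on B (insert v S)) = 2 ^ ?n"
    using assms alt by (simp_all add: card_kernel_on)
  have fin: "finite (kernel_on B S)" "finite (kernel_on B (insert v S))"
    using assms by (simp_all add: finite_kernel_on)
  have "card (kernel_on B (insert v S)) \<le> 2 * card ?Z"
    using fin by (intro card_le_double_card_zeros) (auto intro: add_in_kernel_on)
  moreover have "card (kernel_on B S) \<le> 2 * card ?Z"
    unfolding kernel_on_insert_zeros[OF assms(1,2)]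
    using fin by (intro card_le_double_card_zeros)
      (auto intro: add_in_kernel_on simp: algebra_simps sum.distrib)
  moreover have "card ?Z \<le> card (kernel_on B (insert v S))"
    using fin by (intro card_mono) auto
  moreover have "card ?Z \<le> card (kernel_on B S)"
    unfolding kernel_on_insert_zeros[OF assms(1,2)] using fin by (intro card_mono) auto
  ultimately have "2 ^ ?m \<le> (2::nat) ^ (Suc ?n)" "2 ^ ?n \<le> (2::nat) ^ (Suc ?m)"
    using m n by auto
  then have "?m \<le> Suc ?n" "?n \<le> Suc ?m"
    by (simp_all only: power_increasing_iff one_less_numeral_iff semiring_norm)
  moreover have "even (?m + card S)" "even (?n + Suc (card S))"
    using even_nullity_on[OF assms(1) alt] even_nullity_on[of "insert v S" B] assms by auto
  then have "?m \<noteq> ?n" by auto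
  ultimately show ?thesis by linarith
qed

text \<open>The kernel on \<open>S\<close>, extended by zero, survives in the kernel on
  \<open>insert v S\<close>, so the nullity cannot fall.\<close>

lemma nullity_on_insert_orthogonal:
  assumes "finite S" "v \<notin> S" "alternating_on B (insert v S)"
    and orth: "\<And>g. g \<in> kernel_on B S \<Longrightarrow> (\<Sum>t\<in>S. B v t * g t) = 0"
  shows "nullity_on B (insert v S) = nullity_on B S + 1"
proof -
  have alt: "alternating_on B S"
    using alternating_on_subset[OF assms(3)] by blast
  have "kernel_on B S \<subseteq> kernel_on B (insert v S)"
    using kernel_on_insert_zeros[OF assms(1,2), of B] orth by blast
  then have "card (kernel_on B S) \<le> card (kernel_on B (insert v S))"
    using assms by (intro card_mono finite_kernel_on) auto
  then have "nullity_on B S \<le> nullity_on B (insert v S)"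
    using assms alt by (simp add: card_kernel_on)
  then show ?thesis using nullity_on_insert[OF assms(1-3)] by linarith
qed

text \<open>A kernel vector \<open>g\<close> on \<open>T\<close> that pairs to one with row
  \<open>v\<close> absorbs the toggle: adding \<open>f u * g\<close> to \<open>f\<close> is an
  involution that exchanges the two kernels.\<close>

lemma nullity_on_toggle:
  assumes "finite T" "u \<notin> T" "v \<notin> T" "u \<noteq> v"
    and alt: "alternating_on B (insert u (insert v T))"
    and altC: "alternating_on C (insert u (insert v T))"
    and g: "g \<in> kernel_on B T" "(\<Sum>t\<in>T. B v t * g t) = 1"
    and C: "\<And>s t. C s t = B s t + of_bool ({s, t} = {u, v})"
  shows "nullity_on C (insert u (insert v T)) = nullity_on B (insert u (insert v T))"
proof -
  let ?S = "insert u (insert v T)"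
  let ?e = "\<lambda>f t. f t + f u * g t"
  have sums: "(\<Sum>t\<in>?S. h t) = h u + h v + (\<Sum>t\<in>T. h t)" for h :: "'a \<Rightarrow> bit"
    using assms by (simp add: add.assoc)
  have g0: "g t = 0" if "t \<notin> T" for t using g that by (simp add: kernel_on_def)
  \<comment> \<open>Stated for an arbitrary toggled pair \<open>D\<close>, \<open>E\<close>, because
    the map is needed from \<open>C\<close> to \<open>B\<close> and back.\<close>
  have into: "?e f \<in> kernel_on D ?S"
    if f: "f \<in> kernel_on E ?S" and D: "alternating_on D ?S"
      and DE: "\<And>s t. E s t = D s t + of_bool ({s, t} = {u, v})"
      and gD: "g \<in> kernel_on D T" "(\<Sum>t\<in>T. D v t * g t) = 1" for f D E
  proof -
    have E: "E s t = D s t" if "s \<in> T \<or> t \<in> T \<or> s = t" for s t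
    proof -
      have "{s, t} \<noteq> {u, v}" using that assms(2-4) by (auto simp only: doubleton_eq_iff)
      then show ?thesis by (simp add: DE)
    qed
    have "{v, u} = {u, v}" by blast
    then have Euv: "E u v = D u v + 1" "E v u = D v u + 1"
      by (simp_all add: DE)
    have D0: "D u u = 0" "D v v = 0"
      using D unfolding alternating_on_def by blast+
    have ET: "(\<Sum>t\<in>T. E s t * f t) = (\<Sum>t\<in>T. D s t * f t)" for s
      by (intro sum.cong) (auto simp: E)
    have fu: "(D u v + 1) * f v + (\<Sum>t\<in>T. D u t * f t) = 0"
      and fv: "(D v u + 1) * f u + (\<Sum>t\<in>T. D v t * f t) = 0"
      and fT: "\<And>s. s \<in> T \<Longrightarrow> D s u * f u + D s v * f v + (\<Sum>t\<in>T. D s t * f t) = 0"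
      using f unfolding kernel_on_def sums by (auto simp: E Euv D0 ET)
    have sym: "D s t = D t s" if "s \<in> ?S" "t \<in> ?S" for s t
      using D that by (auto simp: alternating_on_def)
    \<comment> \<open>Pair the equations of the rows in \<open>T\<close> with \<open>g\<close>. By
      symmetry and since \<open>g\<close> is in the kernel on \<open>T\<close>, the part of
      \<open>f\<close> on \<open>T\<close> drops out; as \<open>g\<close> pairs to one with row
      \<open>v\<close>, this expresses \<open>f v\<close> as a multiple of
      \<open>f u\<close>.\<close>
    have "0 = (\<Sum>s\<in>T. g s * (D s u * f u + D s v * f v + (\<Sum>t\<in>T. D s t * f t)))"
      by (simp add: fT)
    also have "\<dots> = (\<Sum>s\<in>T. D u s * g s) * f u + (\<Sum>s\<in>T. D v s * g s) * f v
        + (\<Sum>s\<in>T. \<Sum>t\<in>T. f t * (D t s * g s))"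
      unfolding sum_distrib_right sum.distrib[symmetric]
    proof (rule sum.cong[OF refl])
      fix s assume s: "s \<in> T"
      have "g s * (\<Sum>t\<in>T. D s t * f t) = (\<Sum>t\<in>T. f t * (D t s * g s))"
        unfolding sum_distrib_left using s sym by (intro sum.cong) (auto simp: mult_ac)
      then show "g s * (D s u * f u + D s v * f v + (\<Sum>t\<in>T. D s t * f t))
          = D u s * g s * f u + D v s * g s * f v + (\<Sum>t\<in>T. f t * (D t s * g s))"
        using s sym[of s u] sym[of s v] by (simp add: distrib_left mult_ac)
    qed
    also have "(\<Sum>s\<in>T. \<Sum>t\<in>T. f t * (D t s * g s)) = (\<Sum>t\<in>T. f t * (\<Sum>s\<in>T. D t s * g s))"
      by (subst sum.swap) (simp add: sum_distrib_left)
    also have "\<dots> = 0" using gD by (simp add: kernel_on_def)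
    finally have fvg: "f v = (\<Sum>s\<in>T. D u s * g s) * f u"
      using gD(2) by (metis add.right_neutral bit_add_eq_0_iff mult_1)
    have De: "(\<Sum>t\<in>T. D s t * ?e f t) = (\<Sum>t\<in>T. D s t * f t) + f u * (\<Sum>t\<in>T. D s t * g t)" for s
      by (simp add: algebra_simps sum.distrib sum_distrib_left)
    have gT: "(\<Sum>t\<in>T. D s t * g t) = 0" if "s \<in> T" for s
      using gD that by (simp add: kernel_on_def)
    \<comment> \<open>The correction contributes \<open>f v\<close> to row \<open>u\<close>, by
      \<open>fvg\<close>, and \<open>f u\<close> to row \<open>v\<close>: exactly the terms by which
      the toggle changes these rows.\<close>
    have "D u v * f v + (\<Sum>t\<in>T. D u t * f t) + f u * (\<Sum>t\<in>T. D u t * g t) = 0"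
      using fu fvg by (simp add: algebra_simps)
    moreover have "D v u * f u + (\<Sum>t\<in>T. D v t * f t) + f u = 0"
      using fv by (simp add: algebra_simps)
    moreover have "f t = 0" if "t \<notin> ?S" for t using f that by (simp add: kernel_on_def)
    ultimately show ?thesis
      unfolding kernel_on_def sums mem_Collect_eq De
      using assms(2,3) fT by (auto simp: g0 D0 gT gD(2) add.assoc)
  qed
  have CB: "C s t = B s t" if "t \<in> T" for s t
  proof -
    have "{s, t} \<noteq> {u, v}" using that assms(2,3) by (auto simp only: doubleton_eq_iff)
    then show ?thesis by (simp add: C)
  qed
  have gC: "g \<in> kernel_on C T" "(\<Sum>t\<in>T. C v t * g t) = 1"
    using g by (simp_all add: kernel_on_def CB)
  have BC: "B s t = C s t + of_bool ({s, t} = {u, v})" for s t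
    unfolding C by (simp only: add.assoc bit_add_self add_0_right)
  \<comment> \<open>As \<open>g\<close> vanishes at \<open>u\<close>, the value \<open>f u\<close>
    is kept and the second correction cancels the first.\<close>
  have inv: "?e (?e f) = f" for f
    using assms(2) by (auto simp: g0 add.assoc)
  have "bij_betw ?e (kernel_on C ?S) (kernel_on B ?S)"
  proof (rule bij_betw_byWitness[where f' = ?e])
    show "?e ` kernel_on C ?S \<subseteq> kernel_on B ?S"
      using into[OF _ alt C g] by blast
    show "?e ` kernel_on B ?S \<subseteq> kernel_on C ?S"
      using into[OF _ altC BC gC] by blast
  qed (use inv in blast)+
  then show ?thesis
    by (simp add: nullity_on_def bij_betw_same_card)
qed

lemma power_nullity_on_toggle_le:
  fixes y :: real
  assumes "y \<ge> 0" "finite T" "u \<notin> T" "v \<notin> T" "u \<noteq> v"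
    and alt: "alternating_on B (insert u (insert v T))"
    and altC: "alternating_on C (insert u (insert v T))"
    and C: "\<And>s t. C s t = B s t + of_bool ({s, t} = {u, v})"
  shows "y ^ nullity_on C (insert u (insert v T)) \<le> y ^ nullity_on B (insert u (insert v T))
       + (1 + y) * (y ^ nullity_on B T + y ^ nullity_on B (insert v T))"
proof (cases "\<exists>g\<in>kernel_on B T. (\<Sum>t\<in>T. B v t * g t) = 1")
  case True
  then have "nullity_on C (insert u (insert v T)) = nullity_on B (insert u (insert v T))"
    using nullity_on_toggle[OF assms(2-7) _ _ C] by blast
  then show ?thesis using \<open>y \<ge> 0\<close> by simp
next
  case False
  have "alternating_on B (insert v T)"
    using alternating_on_subset[OF alt] by blast
  then have v: "nullity_on B (insert v T) = nullity_on B T + 1"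
    using False assms by (intro nullity_on_insert_orthogonal) auto
  have "nullity_on C (insert v T) = nullity_on B (insert v T)"
  proof (rule nullity_on_cong)
    fix s t assume "s \<in> insert v T" "t \<in> insert v T"
    then have "{s, t} \<noteq> {u, v}" using assms(3,5) by (auto simp only: doubleton_eq_iff)
    then show "C s t = B s t" by (simp add: C)
  qed
  moreover have "nullity_on C (insert u (insert v T)) = nullity_on C (insert v T) + 1
      \<or> nullity_on C (insert v T) = nullity_on C (insert u (insert v T)) + 1"
    using assms by (intro nullity_on_insert) auto
  ultimately have "nullity_on C (insert u (insert v T)) = nullity_on B T
      \<or> nullity_on C (insert u (insert v T)) = nullity_on B T + 2"
    using v by linarith
  \<comment> \<open>With \<open>k = nullity_on B T\<close> the last summand expands to
    \<open>y^k + 2 * y^(k+1) + y^(k+2)\<close>, which covers both possible powers.\<close>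
  then show ?thesis using \<open>y \<ge> 0\<close> v by (auto simp: algebra_simps)
qed

section \<open>The interlace polynomial as a sum over vertex sets\<close>

definition adj :: "'a ugraph \<Rightarrow> 'a \<Rightarrow> 'a \<Rightarrow> bit" where
  "adj G s t = of_bool ({s, t} \<in> edges G)"

text \<open>This is the subset expansion of the vertex-nullity interlace polynomial;
  \<open>[:-1, 1:]\<close> is \<open>x - 1\<close>.\<close>

definition nullity_sum :: "'a ugraph \<Rightarrow> int poly" where
  "nullity_sum G = (\<Sum>S\<in>Pow (verts G). [:-1, 1:] ^ nullity_on (adj G) S)"

section \<open>Adjacency forms of graphs\<close>

lemma adj_commute: "adj G s t = adj G t s"
  by (simp add: adj_def insert_commute)

lemma adj_self: "finite_simple_graph G \<Longrightarrow> adj G s s = 0"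
  by (force simp: adj_def finite_simple_graph_def)

lemma alternating_on_adj: "finite_simple_graph G \<Longrightarrow> alternating_on (adj G) S"
  by (auto simp: alternating_on_def adj_self intro: adj_commute)

lemma finite_simple_graph_edgeD:
  assumes "finite_simple_graph G" "{a, b} \<in> edges G"
  shows "a \<noteq> b" "a \<in> verts G" "b \<in> verts G"
  using assms by (force simp: finite_simple_graph_def)+

lemma finite_simple_graph_del_vertex:
  "finite_simple_graph G \<Longrightarrow> finite_simple_graph (del_vertex G a)"
  by (auto simp: finite_simple_graph_def del_vertex_def)

lemma finite_simple_graph_toggle_edges:
  assumes "finite_simple_graph G" "\<And>e. e \<in> F \<Longrightarrow> e \<subseteq> verts G \<and> card e = 2"
  shows "finite_simple_graph (toggle_edges G F)"
  using assms by (auto simp: finite_simple_graph_def toggle_edges_def)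

lemma finite_simple_graph_pivot:
  assumes "finite_simple_graph G"
  shows "finite_simple_graph (pivot G a b)"
  unfolding pivot_def using assms
  by (rule finite_simple_graph_toggle_edges)
     (auto simp: adj_only_def adj_both_def card_2_iff)

lemma adj_del_vertex: "s \<noteq> a \<Longrightarrow> t \<noteq> a \<Longrightarrow> adj (del_vertex G a) s t = adj G s t"
  by (simp add: adj_def del_vertex_def)

lemma verts_simps [simp]:
  "verts (del_vertex G a) = verts G - {a}"
  "verts (toggle_edges G F) = verts G"
  "verts (pivot G a b) = verts G"
  by (simp_all add: del_vertex_def toggle_edges_def pivot_def)

lemma nullity_sum_del_vertex:
  "nullity_sum (del_vertex G a) = (\<Sum>S\<in>Pow (verts G - {a}). [:-1, 1:] ^ nullity_on (adj G) S)"
  unfolding nullity_sum_def verts_simps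
proof (rule sum.cong[OF refl])
  fix S assume "S \<in> Pow (verts G - {a})"
  then have "nullity_on (adj (del_vertex G a)) S = nullity_on (adj G) S"
    by (intro nullity_on_cong adj_del_vertex) auto
  then show "[:-1, 1:] ^ nullity_on (adj (del_vertex G a)) S
      = ([:-1, 1:] ^ nullity_on (adj G) S :: int poly)" by simp
qed

lemma sum_Pow_insert:
  fixes f :: "'a set \<Rightarrow> 'b :: comm_monoid_add"
  assumes "finite A" "a \<notin> A"
  shows "sum f (Pow (insert a A)) = (\<Sum>S\<in>Pow A. f S + f (insert a S))"
proof -
  have "sum f (Pow (insert a A)) = sum f (Pow A) + sum f (insert a ` Pow A)"
    unfolding Pow_insert using assms by (intro sum.union_disjoint) auto
  also have "sum f (insert a ` Pow A) = (\<Sum>S\<in>Pow A. f (insert a S))"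
    using assms by (intro sum.reindex_cong[OF _ refl refl] inj_onI) (auto simp: insert_ident)
  finally show ?thesis by (simp add: sum.distrib)
qed

section \<open>Pivots and the recursion\<close>

lemma adj_toggle_edges: "adj (toggle_edges G F) s t = adj G s t + of_bool ({s, t} \<in> F)"
  by (auto simp: adj_def toggle_edges_def)

text \<open>Label each vertex by its adjacencies to \<open>a\<close> and \<open>b\<close>. The added
  terms are the determinant of the labels of \<open>s\<close> and \<open>t\<close>, which over the
  two-element field is nonzero iff the labels are nonzero and distinct, that is, iff the pair is
  toggled.\<close>

lemma adj_pivot:
  assumes "s \<in> verts G - {a, b}" "t \<in> verts G - {a, b}"
  shows "adj (pivot G a b) s t = adj G s t + adj G s b * adj G a t + adj G s a * adj G b t"
proof -
  define R where "R = adj_only G a b \<times> adj_only G b a \<union> adj_only G a b \<times> adj_both G a b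
    \<union> adj_only G b a \<times> adj_both G a b"
  \<comment> \<open>\<open>R\<close> lists each pair of classes in one order only, while an edge is
    unordered.\<close>
  have "{s, t} \<in> {{x, y} | x y. (x, y) \<in> R} \<longleftrightarrow> (s, t) \<in> R \<or> (t, s) \<in> R"
    by (auto simp: doubleton_eq_iff)
  moreover have "of_bool ((s, t) \<in> R \<or> (t, s) \<in> R)
      = adj G s b * adj G a t + adj G s a * adj G b t"
    using assms unfolding adj_commute[of G s b] adj_commute[of G s a]
    by (auto simp: R_def adj_only_def adj_both_def adj_def insert_commute)
  ultimately show ?thesis
    unfolding pivot_def R_def[symmetric] adj_toggle_edges by (simp add: add.assoc)
qed

lemma adj_pivot_endpoint: "adj (pivot G a b) a t = adj G a t"
  unfolding pivot_def adj_toggle_edges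
  by (auto simp: adj_only_def adj_both_def doubleton_eq_iff)

text \<open>Sets avoiding \<open>a\<close> give the first summand. Of those containing
  \<open>a\<close>, the set \<open>T \<union> {a, b}\<close> is matched with \<open>T\<close> by the
  Schur complement, and \<open>T \<union> {a}\<close> with itself by the transvection.\<close>

lemma nullity_sum_edge:
  assumes G: "finite_simple_graph G" and ab: "{a, b} \<in> edges G"
  shows "nullity_sum G = nullity_sum (del_vertex G a) + nullity_sum (del_vertex (pivot G a b) b)"
proof -
  note edge = finite_simple_graph_edgeD[OF G ab]
  define W where "W = verts G - {a, b}"
  have W: "verts G - {a} = insert b W" "verts G - {b} = insert a W"
      "verts G = insert a (insert b W)" "a \<notin> W" "b \<notin> W" "finite W"
    using edge G by (auto simp: W_def finite_simple_graph_def)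
  let ?f = "\<lambda>S. [:-1, 1:] ^ nullity_on (adj G) S :: int poly"
  let ?g = "\<lambda>S. [:-1, 1:] ^ nullity_on (adj (pivot G a b)) S :: int poly"
  have both: "?g T = ?f (insert a (insert b T))" if "T \<subseteq> W" for T
  proof -
    have "card (kernel_on (adj (pivot G a b)) T)
        = card (kernel_on (adj G) (insert a (insert b T)))"
    proof (rule card_kernel_on_pivot)
      show "finite T" "a \<notin> T" "b \<notin> T" using that W finite_subset by auto
      show "adj G a b = 1" using ab by (simp add: adj_def)
      show "adj (pivot G a b) s t = adj G s t + adj G s b * adj G a t + adj G s a * adj G b t"
        if "s \<in> T" "t \<in> T" for s t
        using that \<open>T \<subseteq> W\<close> by (intro adj_pivot) (auto simp: W_def)
    qed (use edge G alternating_on_adj in auto)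
    then show ?thesis by (simp add: nullity_on_def)
  qed
  have one: "?g (insert a T) = ?f (insert a T)" if "T \<subseteq> W" for T
  proof -
    have "card (kernel_on (adj (pivot G a b)) (insert a T)) = card (kernel_on (adj G) (insert a T))"
    proof (rule card_kernel_on_pivot_endpoint)
      show "finite T" "a \<notin> T" using that W finite_subset by auto
      \<comment> \<open>Row \<open>b\<close> of the adjacency form supplies the coefficients
        \<open>c\<close> of the transvection.\<close>
      show "adj (pivot G a b) s t = adj G s t + adj G b s * adj G a t + adj G s a * adj G b t"
        if "s \<in> T" "t \<in> T" for s t
        unfolding adj_commute[of G b s]
        using that \<open>T \<subseteq> W\<close> by (intro adj_pivot) (auto simp: W_def)
      show "adj (pivot G a b) a t = adj G a t \<and> adj (pivot G a b) t a = adj G t a" for t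
        using adj_pivot_endpoint adj_commute by metis
    qed (rule adj_self[OF G])
    then show ?thesis by (simp add: nullity_on_def)
  qed
  have "nullity_sum G = sum ?f (Pow (insert b W)) + (\<Sum>S\<in>Pow (insert b W). ?f (insert a S))"
    unfolding nullity_sum_def W(3) using edge W by (simp add: sum_Pow_insert sum.distrib)
  also have "sum ?f (Pow (insert b W)) = nullity_sum (del_vertex G a)"
    unfolding nullity_sum_del_vertex W(1) ..
  also have "(\<Sum>S\<in>Pow (insert b W). ?f (insert a S))
      = (\<Sum>T\<in>Pow W. ?g T + ?g (insert a T))"
    using W by (simp add: sum_Pow_insert both one add.commute)
  also have "\<dots> = nullity_sum (del_vertex (pivot G a b) b)"
    unfolding nullity_sum_del_vertex verts_simps W(2) using W by (simp add: sum_Pow_insert)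
  finally show ?thesis .
qed

section \<open>Identification with the interlace polynomial\<close>

lemma nullity_sum_no_edges:
  assumes "finite_simple_graph G" "edges G = {}"
  shows "nullity_sum G = monom 1 (card (verts G))"
proof -
  have fin: "finite (verts G)" using assms by (simp add: finite_simple_graph_def)
  have "nullity_on (adj G) S = card S" if "S \<subseteq> verts G" for S
  proof -
    have S: "finite S" using that fin finite_subset by blast
    then have "card (kernel_on (adj G) S) = 2 ^ card S"
      using assms(2) by (intro kernel_on_zero_form) (auto simp: adj_def)
    then show ?thesis
      using card_kernel_on[OF S alternating_on_adj[OF assms(1)]] by simp
  qed
  \<comment> \<open>The factors equal to one bring the sum into the form of the expansion of a
    product of binomials \<open>(x - 1) + 1\<close>, one for each vertex.\<close>
  then have "nullity_sum G
      = (\<Sum>S\<in>Pow (verts G). (\<Prod>t\<in>S. [:-1, 1:]) * (\<Prod>t\<in>verts G - S. 1))"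
    by (simp add: nullity_sum_def)
  also have "\<dots> = (\<Prod>t\<in>verts G. [:-1, 1:] + 1)"
    by (rule prod_add[OF fin, symmetric])
  also have "\<dots> = monom 1 1 ^ card (verts G)"
    by (simp add: one_pCons monom_altdef)
  finally show ?thesis by (simp add: monom_power)
qed

text \<open>Both graphs on the right of the recursion have one vertex fewer, so induction on the
  number of vertices applies.\<close>

lemma interlace_map_unique:
  assumes p: "is_interlace_map p" and q: "is_interlace_map q" and "finite_simple_graph G"
  shows "p G = q G"
  using assms(3)
proof (induction "card (verts G)" arbitrary: G rule: less_induct)
  case less
  show ?case
  proof (cases "edges G = {}")
    case True
    then show ?thesis using p q less.prems by (simp add: is_interlace_map_def)
  next
    case False
    then obtain a b where ab: "{a, b} \<in> edges G"
      using less.prems by (force simp: finite_simple_graph_def card_2_iff)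
    note edge = finite_simple_graph_edgeD[OF less.prems ab]
    have "finite (verts G)" using less.prems by (simp add: finite_simple_graph_def)
    then have "p (del_vertex G a) = q (del_vertex G a)"
      "p (del_vertex (pivot G a b) b) = q (del_vertex (pivot G a b) b)"
      using edge less.prems
      by (auto intro!: less.hyps finite_simple_graph_del_vertex finite_simple_graph_pivot
          psubset_card_mono)
    then show ?thesis using p q less.prems ab unfolding is_interlace_map_def by metis
  qed
qed

lemma interlace_poly_eq_nullity_sum:
  fixes G :: "'a ugraph"
  assumes "finite_simple_graph G"
  shows "interlace_poly G = nullity_sum G"
proof -
  \<comment> \<open>The restriction supplies the default value that extensionality demands off the
    finite simple graphs.\<close>
  define q :: "'a ugraph \<Rightarrow> int poly" where "q = restrict nullity_sum {G. finite_simple_graph G}"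
  have q: "is_interlace_map q"
    by (auto simp: is_interlace_map_def q_def nullity_sum_no_edges nullity_sum_edge
        finite_simple_graph_del_vertex finite_simple_graph_pivot)
  have "p = q" if "is_interlace_map p" for p
    using that q interlace_map_unique[OF that q]
    by (auto simp: is_interlace_map_def intro: extensionalityI)
  then have "interlace_poly = q"
    unfolding interlace_poly_def using q by (intro the_equality)
  then have "interlace_poly G = q G" by (rule fun_cong)
  then show ?thesis using assms by (simp add: q_def)
qed

section \<open>Evaluation at a real number\<close>

lemma poly_map_of_int_nullity_sum:
  "poly (map_poly real_of_int (\<Sum>S\<in>A. [:-1, 1:] ^ n S)) x = (\<Sum>S\<in>A. (x - 1) ^ n S)"
proof -
  have add: "map_poly real_of_int (p + q) = map_poly real_of_int p + map_poly real_of_int q" for p q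
    by (rule poly_eqI) (simp add: coeff_map_poly)
  have sub: "map_poly real_of_int (p - q) = map_poly real_of_int p - map_poly real_of_int q" for p q
    by (rule poly_eqI) (simp add: coeff_map_poly)
  have pow: "poly (map_poly real_of_int ([:-1, 1:] ^ k)) x = (x - 1) ^ k" for k
  proof (induction k)
    case (Suc k)
    \<comment> \<open>Multiplication by \<open>x - 1\<close> is split into a shift and a difference,
      both of which commute with the coercion of coefficients.\<close>
    have "[:-1, 1:] ^ Suc k = pCons 0 ([:-1, 1:] ^ k) - ([:-1, 1:] ^ k :: int poly)"
      by simp
    then show ?case
      using Suc by (simp only: sub map_poly_pCons) (simp add: algebra_simps)
  qed simp
  show ?thesis
    by (induction A rule: infinite_finite_induct) (simp_all add: add pow)
qed

section \<open>The inequality for a pendant vertex\<close>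

theorem theorem44:
  fixes H :: "'a ugraph" and u v w :: 'a and x :: real
  assumes "finite_simple_graph H"
    and "u \<in> verts H" "v \<in> verts H" "w \<in> verts H"
    and "u \<noteq> v" "u \<noteq> w" "v \<noteq> w"
    and "{u, w} \<in> edges H"
    and "\<forall>e\<in>edges H. w \<in> e \<longrightarrow> e = {u, w}"
    and "x \<ge> 1"
  shows "poly (map_poly real_of_int (interlace_poly (toggle_edges (del_vertex H w) {{u, v}}))) x
       \<le> poly (map_poly real_of_int (interlace_poly H)) x"
proof -
  define K where "K = del_vertex H w"
  define G where "G = toggle_edges K {{u, v}}"
  define W where "W = verts H - {u, v, w}"
  have W: "verts H - {w} = insert u (insert v W)" "verts H - {u} = insert w (insert v W)"
      "u \<notin> W" "v \<notin> W" "w \<notin> W" "finite W"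
    using assms by (auto simp: W_def finite_simple_graph_def)
  have K: "finite_simple_graph K"
    unfolding K_def using assms(1) by (rule finite_simple_graph_del_vertex)
  have G: "finite_simple_graph G"
    unfolding G_def using K by (rule finite_simple_graph_toggle_edges) (use assms in \<open>auto simp: K_def\<close>)
  have C: "adj G s t = adj K s t + of_bool ({s, t} = {u, v})" for s t
    by (simp add: G_def adj_toggle_edges)
  have w0: "adj H w t = 0" if "t \<noteq> u" for t
  proof -
    have "{w, t} \<noteq> {u, w}" using that assms(6) by (auto simp only: doubleton_eq_iff)
    then show ?thesis using assms(9) by (auto simp: adj_def)
  qed
  \<comment> \<open>As \<open>u\<close> is the only neighbour of \<open>w\<close>, each product of
    classes toggled by the pivot on \<open>wu\<close> has an empty factor. With \<open>w\<close> in
    the role of \<open>a\<close>, the recursion reads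
    \<open>q(H) = q(H - w) + q(H - u)\<close>.\<close>
  have "{w, t} \<notin> edges H" if "t \<noteq> u" for t
    using w0[OF that] by (auto simp: adj_def)
  then have "adj_only H w u = {}" "adj_both H w u = {}"
    by (auto simp: adj_only_def adj_both_def)
  then have "pivot H w u = H"
    by (simp add: pivot_def toggle_edges_def)
  moreover have "{w, u} \<in> edges H" using assms(8) by (simp add: insert_commute)
  ultimately have rec: "nullity_sum H = nullity_sum K + nullity_sum (del_vertex H u)"
    using nullity_sum_edge[OF assms(1), of w u] by (simp add: K_def)

  let ?y = "x - 1"
  let ?f = "\<lambda>S. ?y ^ nullity_on (adj K) S"
  let ?q = "\<lambda>G. poly (map_poly real_of_int (nullity_sum G)) x"
  have HK: "nullity_on (adj H) S = nullity_on (adj K) S" if "w \<notin> S" for S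
    unfolding K_def using that by (intro nullity_on_cong adj_del_vertex[symmetric]) auto
  \<comment> \<open>Without \<open>u\<close> the vertex \<open>w\<close> is isolated, so its row is
    zero and orthogonal to every kernel vector.\<close>
  have pendant: "nullity_on (adj H) (insert w S) = nullity_on (adj K) S + 1"
    if "S \<subseteq> insert v W" for S
  proof -
    have S: "finite S" "w \<notin> S" "u \<notin> S" using that W assms finite_subset[OF that] by auto
    then have "nullity_on (adj H) (insert w S) = nullity_on (adj H) S + 1"
      using assms(1) by (intro nullity_on_insert_orthogonal alternating_on_adj sum.neutral)
        (auto intro!: w0)
    then show ?thesis using HK S by simp
  qed
  have toggled: "nullity_on (adj G) S = nullity_on (adj K) S" if "u \<notin> S \<or> v \<notin> S" for S
  proof (rule nullity_on_cong)
    fix s t assume "s \<in> S" "t \<in> S"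
    then have "{s, t} \<noteq> {u, v}" using that by (auto simp only: doubleton_eq_iff)
    then show "adj G s t = adj K s t" by (simp add: C)
  qed

  \<comment> \<open>Vertex sets are grouped by their intersection \<open>T\<close> with
    \<open>W\<close>.\<close>
  have qK: "?q K = (\<Sum>T\<in>Pow W. ?f T + ?f (insert v T) + ?f (insert u T) + ?f (insert u (insert v T)))"
    unfolding nullity_sum_def poly_map_of_int_nullity_sum
    using W assms by (simp add: K_def sum_Pow_insert sum.distrib add_ac)
  have qG: "?q G = (\<Sum>T\<in>Pow W. ?f T + ?f (insert v T) + ?f (insert u T)
      + ?y ^ nullity_on (adj G) (insert u (insert v T)))"
  proof -
    have "?q G = (\<Sum>S\<in>Pow (insert u (insert v W)). ?y ^ nullity_on (adj G) S)"
      unfolding nullity_sum_def poly_map_of_int_nullity_sum by (simp add: G_def K_def W)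
    also have "\<dots> = (\<Sum>T\<in>Pow W. ?y ^ nullity_on (adj G) T + ?y ^ nullity_on (adj G) (insert v T)
        + ?y ^ nullity_on (adj G) (insert u T) + ?y ^ nullity_on (adj G) (insert u (insert v T)))"
      using W assms by (simp add: sum_Pow_insert sum.distrib add_ac)
    also have "\<dots> = (\<Sum>T\<in>Pow W. ?f T + ?f (insert v T) + ?f (insert u T)
      + ?y ^ nullity_on (adj G) (insert u (insert v T)))"
    proof (rule sum.cong[OF refl])
      fix T assume "T \<in> Pow W"
      then have "u \<notin> T" "v \<notin> T" using W by auto
      then show "?y ^ nullity_on (adj G) T + ?y ^ nullity_on (adj G) (insert v T)
          + ?y ^ nullity_on (adj G) (insert u T) + ?y ^ nullity_on (adj G) (insert u (insert v T))
        = ?f T + ?f (insert v T) + ?f (insert u T) + ?y ^ nullity_on (adj G) (insert u (insert v T))"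
        using assms(5) by (simp add: toggled)
    qed
    finally show ?thesis .
  qed
  \<comment> \<open>Pairing \<open>S\<close> with \<open>insert w S\<close> produces the factor
    \<open>1 + (x - 1) = x\<close>, which turns \<open>q(H - u)\<close> into
    \<open>x q(H - w - u)\<close>.\<close>
  have qu: "?q (del_vertex H u) = (\<Sum>T\<in>Pow W. (1 + ?y) * (?f T + ?f (insert v T)))"
  proof -
    have "?q (del_vertex H u)
        = (\<Sum>S\<in>Pow (insert v W). ?y ^ nullity_on (adj H) S + ?y ^ nullity_on (adj H) (insert w S))"
      unfolding nullity_sum_del_vertex poly_map_of_int_nullity_sum W(2)
      using W assms by (intro sum_Pow_insert) auto
    also have "\<dots> = (\<Sum>S\<in>Pow (insert v W). (1 + ?y) * ?f S)"
    proof (rule sum.cong[OF refl])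
      fix S assume "S \<in> Pow (insert v W)"
      moreover from this have "w \<notin> S" using W assms by auto
      ultimately show "?y ^ nullity_on (adj H) S + ?y ^ nullity_on (adj H) (insert w S)
          = (1 + ?y) * ?f S"
        by (simp add: HK pendant algebra_simps)
    qed
    also have "\<dots> = (\<Sum>T\<in>Pow W. (1 + ?y) * (?f T + ?f (insert v T)))"
      using W by (simp add: sum_Pow_insert distrib_left)
    finally show ?thesis .
  qed
  \<comment> \<open>The comparison is made separately for each \<open>T\<close>; only the set
    \<open>T \<union> {u, v}\<close> sees the toggled edge.\<close>
  have "?q G \<le> (\<Sum>T\<in>Pow W. ?f T + ?f (insert v T) + ?f (insert u T) + ?f (insert u (insert v T))
      + (1 + ?y) * (?f T + ?f (insert v T)))"
    unfolding qG
  proof (rule sum_mono)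
    fix T assume "T \<in> Pow W"
    then have "finite T" "u \<notin> T" "v \<notin> T" using W finite_subset by auto
    then have "?y ^ nullity_on (adj G) (insert u (insert v T))
        \<le> ?f (insert u (insert v T)) + (1 + ?y) * (?f T + ?f (insert v T))"
      using assms(5,10) K G C
      by (intro power_nullity_on_toggle_le alternating_on_adj) auto
    then show "?f T + ?f (insert v T) + ?f (insert u T)
          + ?y ^ nullity_on (adj G) (insert u (insert v T))
        \<le> ?f T + ?f (insert v T) + ?f (insert u T) + ?f (insert u (insert v T))
          + (1 + ?y) * (?f T + ?f (insert v T))"
      by linarith
  qed
  also have "\<dots> = ?q K + ?q (del_vertex H u)"
    unfolding qK qu by (simp only: sum.distrib)
  also have "\<dots> = ?q H"
  proof -
    have "map_poly real_of_int (nullity_sum H)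
        = map_poly real_of_int (nullity_sum K) + map_poly real_of_int (nullity_sum (del_vertex H u))"
      unfolding rec by (rule poly_eqI) (simp add: coeff_map_poly)
    then show ?thesis by simp
  qed
  finally show ?thesis
    using G assms(1) by (simp add: interlace_poly_eq_nullity_sum G_def K_def)
qed

end
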